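(* Let $Y$ be a proximinal finite co-dimensional (closed linear) subspace of $c_0$. Then the triplet $(\ell_\infty,B_Y,\mathcal{CB}(\ell_\infty))$ has property-$(P_1)$.
   Context: All Banach spaces are real; $Y\subseteq c_0\subseteq\ell_\infty$ carry the supremum norm. A subspace $Y$ of a Banach space $E$ is proximinal in $E$ if for each $x\in E$ there is $y\in Y$ with $\|x-y\|=\inf_{y'\in Y}\|x-y'\|$. For a Banach space $E$, $B_E$ is its closed unit ball and $\mathcal{CB}(E)$ is the class of non-empty closed bounded subsets of $E$. For $v\in E$ and a non-empty bounded set $F\subseteq E$, $r(v,F)=\sup_{z\in F}\|v-z\|$. For a non-empty closed convex $V\subseteq E$: $\mathrm{rad}_V(F)=\inf_{v\in V}r(v,F)$, $\mathrm{cent}_V(F)=\{v\in V: r(v,F)=\mathrm{rad}_V(F)\}$, and for $\delta>0$, $\mathrm{cent}_V(F,\delta)=\{v\in V: r(v,F)\le \mathrm{rad}_V(F)+\delta\}$. For $\mathscr F\subseteq\mathcal{CB}(E)$, the pair $(V,\mathscr F)$ has the restricted center property (r.c.p.) if $\mathrm{cent}_V(F)\ne\emptyset$ for every $F\in\mathscr F$. The triplet $(E,V,\mathscr F)$ has property-$(P_1)$ if $(V,\mathscr F)$ has r.c.p. and for every $\varepsilon>0$ and $F\in\mathscr F$ there is $\delta>0$ with $\mathrm{cent}_V(F,\delta)\subseteq\mathrm{cent}_V(F)+\varepsilon B_E$. *)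

theory Defs
  imports "HOL-Analysis.Analysis"
begin

(* nat carries the discrete topology, so nat \<Rightarrow>\<^sub>C real consists of all bounded real sequences;
   its norm is the supremum norm. *)
type_synonym linfty = "nat \<Rightarrow>\<^sub>C real"

definition c0 :: "linfty set" where
  "c0 = {x. apply_bcontfun x \<longlonglongrightarrow> 0}"

(* For a subspace Y of X: the cosets of finitely many elements of X span X / Y. *)
definition finite_codim_in :: "'a::real_vector set \<Rightarrow> 'a set \<Rightarrow> bool" where
  "finite_codim_in Y X \<longleftrightarrow> (\<exists>B. finite B \<and> B \<subseteq> X \<and> X = span (Y \<union> B))"

definition proximinal_in :: "'a::real_normed_vector set \<Rightarrow> 'a set \<Rightarrow> bool" where
  "proximinal_in Y E \<longleftrightarrow> (\<forall>x\<in>E. \<exists>y\<in>Y. norm (x - y) = (INF y'\<in>Y. norm (x - y')))"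

definition CB :: "'a::real_normed_vector set set" where
  "CB = {F. F \<noteq> {} \<and> closed F \<and> bounded F}"

(* The real-valued suprema and infima in remote_radius and rad are the intended ones
   because F is non-empty and bounded and V is non-empty in all uses. *)
definition remote_radius :: "'a::real_normed_vector \<Rightarrow> 'a set \<Rightarrow> real" where
  "remote_radius v F = (SUP z\<in>F. norm (v - z))"

definition rad :: "'a::real_normed_vector set \<Rightarrow> 'a set \<Rightarrow> real" where
  "rad V F = (INF v\<in>V. remote_radius v F)"

definition cent :: "'a::real_normed_vector set \<Rightarrow> 'a set \<Rightarrow> 'a set" where
  "cent V F = {v\<in>V. remote_radius v F = rad V F}"

definition near_cent :: "'a::real_normed_vector set \<Rightarrow> 'a set \<Rightarrow> real \<Rightarrow> 'a set" where
  "near_cent V F \<delta> = {v\<in>V. remote_radius v F \<le> rad V F + \<delta>}"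

definition rcp :: "'a::real_normed_vector set \<Rightarrow> 'a set set \<Rightarrow> bool" where
  "rcp V \<F> \<longleftrightarrow> (\<forall>F\<in>\<F>. cent V F \<noteq> {})"

(* The ambient space E of the triplet (E, V, \<F>) is the whole type 'a. *)
definition property_P1 :: "'a::real_normed_vector set \<Rightarrow> 'a set set \<Rightarrow> bool" where
  "property_P1 V \<F> \<longleftrightarrow> rcp V \<F> \<and>
     (\<forall>\<epsilon>>0. \<forall>F\<in>\<F>. \<exists>\<delta>>0.
        near_cent V F \<delta> \<subseteq> {c + \<epsilon> *\<^sub>R b | c b. c \<in> cent V F \<and> b \<in> cball 0 1})"

end

theory Submission
  imports Defs
begin

text \<open>Proximinality of \<open>Y\<close> forces every functional vanishing on \<open>Y\<close> to attain its norm on \<open>c\<^sub>0\<close>,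
  hence to have finite support. So membership in \<open>Y\<close> depends on finitely many coordinates only:
  \<open>Y\<close> contains every null sequence that vanishes below some \<open>N\<close>. Since
  \<open>r(v, F) = sup\<^sub>k sup\<^sub>z \<bar>v\<^sub>k - z\<^sub>k\<bar>\<close> decouples over the coordinates, a near-center can be corrected to a
  center separately on the first \<open>N\<close> coordinates, by compactness, and on the tail, by clamping each
  coordinate to the interval of admissible values.\<close>

text \<open>Bolzano-Weierstrass, applied to one index after another: each index of \<open>B\<close>
  refines the subsequence found for the earlier ones. It replaces compactness in the
  finite-dimensional arguments below.\<close>

lemma finite_convergent_subsequence:
  fixes h :: "nat \<Rightarrow> 'b \<Rightarrow> real"
  assumes "finite B" and "\<And>b. b \<in> B \<Longrightarrow> bounded (range (\<lambda>n. h n b))"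
  shows "\<exists>r c. strict_mono r \<and> (\<forall>b\<in>B. (\<lambda>n. h (r n) b) \<longlonglongrightarrow> c b)"
  using assms
proof (induction B rule: finite_induct)
  case empty
  then show ?case using strict_mono_id by auto
next
  case (insert a B)
  then obtain r c where r: "strict_mono r" "\<forall>b\<in>B. (\<lambda>n. h (r n) b) \<longlonglongrightarrow> c b"
    by auto
  have "bounded (range (\<lambda>n. h (r n) a))"
    using insert.prems[of a] by (auto intro: bounded_subset)
  from bounded_imp_convergent_subsequence[OF this]
  obtain l s where s: "strict_mono s" "((\<lambda>n. h (r n) a) \<circ> s) \<longlonglongrightarrow> l" by blast
  have "(\<lambda>n. h ((r \<circ> s) n) b) \<longlonglongrightarrow> (c(a := l)) b" if "b \<in> insert a B" for b
    using that r s LIMSEQ_subseq_LIMSEQ[of "\<lambda>n. h (r n) b" "c b" s] insert.hyps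
    by (auto simp: o_def)
  then show ?case using strict_mono_o[OF r(1) s(1)] by blast
qed

subsection \<open>Subspaces of finite codimension\<close>

text \<open>Fix \<open>b\<close> with \<open>f b\<close> nonzero. If \<open>f x\<close> is nonzero,
  subtracting the right multiple of \<open>x\<close> from \<open>b\<close> lands in the kernel, so
  \<open>norm x\<close> is bounded below in terms of the distance from \<open>b\<close> to the
  kernel. That distance is positive because the kernel is closed.\<close>

lemma bounded_functional_of_closed_kernel:
  fixes f :: "'a::real_normed_vector \<Rightarrow> real"
  assumes X: "subspace X" and f: "linear f" and cl: "closed {x\<in>X. f x = 0}"
  shows "\<exists>C\<ge>0. \<forall>x\<in>X. \<bar>f x\<bar> \<le> C * norm x"
proof (cases "\<exists>b\<in>X. f b \<noteq> 0")
  case False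
  then show ?thesis by (intro exI[of _ 0]) auto
next
  case True
  then obtain b where b: "b \<in> X" "f b \<noteq> 0" by auto
  define H where "H = {x\<in>X. f x = 0}"
  have "0 \<in> H" using X f by (auto simp: H_def subspace_0 linear_0)
  then have d: "infdist b H > 0"
    using infdist_pos_not_in_closed[of H b] cl b by (auto simp: H_def)
  have "\<bar>f x\<bar> \<le> (\<bar>f b\<bar> / infdist b H) * norm x" if x: "x \<in> X" for x
  proof (cases "f x = 0")
    case False
    have "b - (f b / f x) *\<^sub>R x \<in> H"
      using X f b x False by (simp add: H_def subspace_diff subspace_scale linear_diff linear_cmul)
    from infdist_le[OF this, of b] have "infdist b H \<le> (\<bar>f b\<bar> / \<bar>f x\<bar>) * norm x"
      by (simp add: dist_norm)
    then show ?thesis using d False by (simp add: field_simps)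
  qed (use d in auto)
  then show ?thesis using d by (intro exI[of _ "\<bar>f b\<bar> / infdist b H"]) auto
qed

text \<open>Coordinates on the quotient of \<open>span (Y \<union> B)\<close> by \<open>Y\<close>,
  without forming the quotient: a basis of \<open>Y\<close> is extended by some
  \<open>D \<subseteq> B\<close>, and \<open>g b\<close> is the coordinate functional dual to
  \<open>b\<close>. The remainder \<open>h\<close> is linear and maps every basis vector into
  \<open>Y\<close>, hence the whole span.\<close>

lemma codim_coordinates:
  fixes Y :: "'a::real_vector set"
  assumes Y: "subspace Y" and B: "finite B"
  shows "\<exists>D g. finite D \<and> D \<subseteq> B \<and>
    (\<forall>b\<in>D. linear (g b :: 'a \<Rightarrow> real) \<and> (\<forall>y\<in>Y. g b y = 0) \<and> (\<forall>d\<in>D. g b d = (if d = b then 1 else 0))) \<and>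
    (\<forall>x\<in>span (Y \<union> B). x - (\<Sum>b\<in>D. g b x *\<^sub>R b) \<in> Y)"
proof -
  obtain A where A: "A \<subseteq> Y" "independent A" "Y \<subseteq> span A"
    using maximal_independent_subset[of Y] by blast
  obtain A' where A': "A \<subseteq> A'" "A' \<subseteq> A \<union> B" "independent A'" "A \<union> B \<subseteq> span A'"
    using maximal_independent_subset_extend[OF Un_upper1 A(2), of B] by blast
  define D where "D = A' - A"
  have DB: "D \<subseteq> B" "finite D" using A' B by (auto simp: D_def intro: finite_subset)
  have "\<forall>b. \<exists>g. linear g \<and> (\<forall>x\<in>A'. g x = (if x = b then 1 else 0::real))"
    by (intro allI linear_independent_extend[OF A'(3)])
  from choice[OF this] obtain g
    where "\<forall>b. linear (g b) \<and> (\<forall>x\<in>A'. g b x = (if x = b then 1 else 0::real))" ..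
  then have g: "\<And>b. linear (g b)" "\<And>b x. x \<in> A' \<Longrightarrow> g b x = (if x = b then 1 else 0::real)"
    by blast+
  have g0: "g b y = 0" if "b \<in> D" "y \<in> Y" for b y
  proof -
    have "\<forall>x\<in>A. g b x = 0" using g(2) that A' by (auto simp: D_def)
    then show ?thesis
      using linear_eq_0_on_span[OF g(1), of A b y] that A by auto
  qed
  have gd: "g b d = (if d = b then 1 else 0)" if "d \<in> D" for b d
    using g(2) that by (auto simp: D_def)
  define h where "h x = x - (\<Sum>b\<in>D. g b x *\<^sub>R b)" for x
  have lh: "linear h"
    by (rule linearI)
       (simp_all add: h_def linear_add[OF g(1)] linear_cmul[OF g(1)] algebra_simps sum.distrib scaleR_sum_right)
  have hA: "h x \<in> Y" if "x \<in> A'" for x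
  proof (cases "x \<in> A")
    case True
    then have "(\<Sum>b\<in>D. g b x *\<^sub>R b) = 0" using g0 A by (intro sum.neutral) auto
    then show ?thesis using A True by (auto simp: h_def)
  next
    case False
    then have "x \<in> D" using that by (auto simp: D_def)
    then have "(\<Sum>b\<in>D. g b x *\<^sub>R b) = (\<Sum>b\<in>D. if b = x then x else 0)"
      using gd by (intro sum.cong) auto
    also have "\<dots> = x" using \<open>x \<in> D\<close> DB by simp
    finally show ?thesis using Y by (simp add: h_def subspace_0)
  qed
  have "Y \<union> B \<subseteq> span A'"
    using A(3) A'(4) span_mono[OF A'(1)] by auto
  then have sub: "span (Y \<union> B) \<subseteq> span A'" by (simp add: span_minimal subspace_span)
  have "h x \<in> Y" if "x \<in> span A'" for x
    using that
  proof (induction rule: span_induct)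
    show "subspace {x. h x \<in> Y}" using linear_subspace_vimage[OF lh Y] by (simp add: vimage_def)
  qed (use hA in auto)
  with sub have hY: "\<And>x. x \<in> span (Y \<union> B) \<Longrightarrow> x - (\<Sum>b\<in>D. g b x *\<^sub>R b) \<in> Y"
    by (auto simp: h_def)
  show ?thesis
    by (intro exI[of _ D] exI[of _ g] conjI ballI DB g(1) g0 gd hY)
qed

text \<open>The \<open>b\<close>-coordinate has kernel \<open>Y\<close>, which is closed, so it is
  bounded. Along a convergent sequence the \<open>b\<close>-coordinates are therefore Cauchy in the
  reals, and what remains converges inside \<open>Y\<close>.\<close>

lemma closed_span_insert:
  fixes Y :: "'a::real_normed_vector set"
  assumes Y: "subspace Y" and cl: "closed Y"
  shows "closed (span (insert b Y))"
proof (cases "b \<in> Y")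
  case True
  then have "insert b Y = Y" "span Y = Y" using Y by auto
  then show ?thesis using cl by metis
next
  case False
  define X where "X = span (insert b Y)"
  obtain D g where "finite D \<and> D \<subseteq> {b} \<and>
    (\<forall>b\<in>D. linear (g b :: 'a \<Rightarrow> real) \<and> (\<forall>y\<in>Y. g b y = 0) \<and> (\<forall>d\<in>D. g b d = (if d = b then 1 else 0))) \<and>
    (\<forall>x\<in>X. x - (\<Sum>b\<in>D. g b x *\<^sub>R b) \<in> Y)"
    using codim_coordinates[OF Y finite.insertI[OF finite.emptyI], of b]
    unfolding X_def Un_insert_right sup_bot_right by (elim exE)
  then have D: "finite D" "D \<subseteq> {b}"
    and g: "\<And>b. b \<in> D \<Longrightarrow> linear (g b)"
      "\<And>b y. b \<in> D \<Longrightarrow> y \<in> Y \<Longrightarrow> g b y = 0"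
      "\<And>b d. b \<in> D \<Longrightarrow> d \<in> D \<Longrightarrow> g b d = (if d = b then 1 else 0)"
      "\<And>x. x \<in> X \<Longrightarrow> x - (\<Sum>b\<in>D. g b x *\<^sub>R b) \<in> Y"
    by blast+
  have bX: "b \<in> X" "Y \<subseteq> X" by (auto simp: X_def intro: span_base)
  \<comment> \<open>An empty \<open>D\<close> would put \<open>b\<close> itself into
    \<open>Y\<close>.\<close>
  have Db: "D = {b}"
    using g(4)[OF bX(1)] False D(2) by (cases "D = {}") auto
  then have f: "linear (g b)" "\<And>y. y \<in> Y \<Longrightarrow> g b y = 0"
    using g(1,2) by blast+
  have f3: "x - g b x *\<^sub>R b \<in> Y" if "x \<in> X" for x
    using g(4)[OF that] unfolding Db by simp
  have "{x\<in>X. g b x = 0} = Y"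
  proof safe
    fix x assume "x \<in> X" "g b x = 0"
    then show "x \<in> Y" using f3[of x] by simp
  qed (use f(2) bX(2) in auto)
  then have "closed {x\<in>X. g b x = 0}" using cl by metis
  then obtain C where C: "C \<ge> 0" "\<forall>x\<in>X. \<bar>g b x\<bar> \<le> C * norm x"
    using bounded_functional_of_closed_kernel[OF _ f(1)] subspace_span[of "insert b Y"]
    unfolding X_def by blast
  have "closed X"
    unfolding closed_sequential_limits
  proof safe
    fix x l assume x: "\<forall>n. x n \<in> X" "x \<longlonglongrightarrow> l"
    have "Cauchy (\<lambda>n. g b (x n))"
    proof (rule CauchyI)
      fix e :: real assume "e > 0"
      \<comment> \<open>The divisor is \<open>C + 1\<close> because \<open>C\<close> may be
        0.\<close>
      then have "e / (C + 1) > 0" using C by simp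
      then obtain M where M: "\<forall>m\<ge>M. \<forall>n\<ge>M. norm (x m - x n) < e / (C + 1)"
        using CauchyD[OF LIMSEQ_imp_Cauchy[OF x(2)]] by blast
      have "norm (g b (x m) - g b (x n)) < e" if "m \<ge> M" "n \<ge> M" for m n
      proof -
        have "x m - x n \<in> X" using x(1) by (simp add: X_def span_diff)
        then have "norm (g b (x m) - g b (x n)) \<le> C * norm (x m - x n)"
          using C(2) by (metis linear_diff[OF f(1)] real_norm_def)
        also have "\<dots> \<le> (C + 1) * norm (x m - x n)" by (simp add: mult_right_mono)
        also have "\<dots> < e" using M that C(1) by (simp add: field_simps)
        finally show ?thesis .
      qed
      then show "\<exists>M. \<forall>m\<ge>M. \<forall>n\<ge>M. norm (g b (x m) - g b (x n)) < e" by blast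
    qed
    then obtain t where "(\<lambda>n. g b (x n)) \<longlonglongrightarrow> t"
      using convergent_eq_Cauchy by blast
    then have "(\<lambda>n. x n - g b (x n) *\<^sub>R b) \<longlonglongrightarrow> l - t *\<^sub>R b"
      using x(2) by (intro tendsto_intros)
    then have "l - t *\<^sub>R b \<in> Y"
      by (rule closed_sequentially[OF cl, rotated]) (use f3 x(1) in simp)
    then have "l - t *\<^sub>R b \<in> X" using bX(2) by blast
    then have "(l - t *\<^sub>R b) + t *\<^sub>R b \<in> X"
      using bX(1) unfolding X_def by (intro span_add span_scale)
    then show "l \<in> X" by simp
  qed
  then show ?thesis by (simp add: X_def)
qed

text \<open>Adjoins one vector at a time. Its use is for kernels of coordinate functionals, which
  are finite extensions of \<open>Y\<close>.\<close>

lemma closed_span_Un_finite: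
  fixes Y :: "'a::real_normed_vector set"
  assumes "finite B" "subspace Y" "closed Y"
  shows "closed (span (Y \<union> B))"
  using assms(1)
proof (induction B)
  case empty
  have "span Y = Y" using assms by (simp add: span_eq_iff)
  then show ?case using assms by (metis sup_bot_right)
next
  case (insert b B)
  have "span (Y \<union> insert b B) = span (insert b (span (Y \<union> B)))"
  proof (rule subset_antisym; rule span_minimal)
    show "Y \<union> insert b B \<subseteq> span (insert b (span (Y \<union> B)))"
      by (meson Un_least insert_subset span_base span_superset subset_insertI subset_trans sup.boundedE insertI1)
    show "insert b (span (Y \<union> B)) \<subseteq> span (Y \<union> insert b B)"
      using span_mono[of "Y \<union> B" "Y \<union> insert b B"] span_base[of b "Y \<union> insert b B"] by blast
  qed (rule subspace_span)+
  then show ?case using closed_span_insert[OF subspace_span insert.IH] by simp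
qed

text \<open>Proximinality says that the quotient map sends the closed unit ball of \<open>X\<close> onto that of
  \<open>X / Y\<close>, which is compact, so functionals that vanish on \<open>Y\<close> attain their norm.\<close>

lemma proximinal_functional_attains:
  fixes f :: "'a::real_normed_vector \<Rightarrow> real"
  assumes Y: "subspace Y" "closed Y" and B: "finite B" and prox: "proximinal_in Y (span (Y \<union> B))"
    and f: "linear f" "\<And>y. y \<in> Y \<Longrightarrow> f y = 0"
  shows "\<exists>x\<in>span (Y \<union> B). norm x \<le> 1 \<and> (\<forall>z\<in>span (Y \<union> B). norm z \<le> 1 \<longrightarrow> f z \<le> f x)"
proof -
  define X where "X = span (Y \<union> B)"
  have X: "subspace X" "Y \<subseteq> X" "B \<subseteq> X" by (auto simp: X_def intro: span_base)
  obtain D g where "finite D \<and> D \<subseteq> B \<and>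
    (\<forall>b\<in>D. linear (g b :: 'a \<Rightarrow> real) \<and> (\<forall>y\<in>Y. g b y = 0) \<and> (\<forall>d\<in>D. g b d = (if d = b then 1 else 0))) \<and>
    (\<forall>x\<in>X. x - (\<Sum>b\<in>D. g b x *\<^sub>R b) \<in> Y)"
    using codim_coordinates[OF Y(1) B] unfolding X_def by (elim exE)
  then have D: "finite D" "D \<subseteq> B"
    and g: "\<And>b. b \<in> D \<Longrightarrow> linear (g b)"
      "\<And>b y. b \<in> D \<Longrightarrow> y \<in> Y \<Longrightarrow> g b y = 0"
      "\<And>b d. b \<in> D \<Longrightarrow> d \<in> D \<Longrightarrow> g b d = (if d = b then 1 else 0)"
      "\<And>x. x \<in> X \<Longrightarrow> x - (\<Sum>b\<in>D. g b x *\<^sub>R b) \<in> Y"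
    by blast+
  \<comment> \<open>The kernel of \<open>g b\<close> in \<open>X\<close> is spanned by
    \<open>Y\<close> and the other vectors of \<open>D\<close>, hence it is closed and
    \<open>g b\<close> is bounded.\<close>
  have bdd: "\<exists>C\<ge>0. \<forall>x\<in>X. \<bar>g b x\<bar> \<le> C * norm x" if b: "b \<in> D" for b
  proof (rule bounded_functional_of_closed_kernel[OF X(1) g(1)[OF b]])
    have "{x\<in>X. g b x = 0} = span (Y \<union> (D - {b}))"
    proof safe
      fix x assume x: "x \<in> X" "g b x = 0"
      have "(\<Sum>d\<in>D. g d x *\<^sub>R d) = (\<Sum>d\<in>D - {b}. g d x *\<^sub>R d)"
        using D x by (intro sum.mono_neutral_right) auto
      then have "x - (\<Sum>d\<in>D - {b}. g d x *\<^sub>R d) \<in> Y" using g(4)[OF x(1)] by simp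
      then have "(x - (\<Sum>d\<in>D - {b}. g d x *\<^sub>R d)) + (\<Sum>d\<in>D - {b}. g d x *\<^sub>R d) \<in> span (Y \<union> (D - {b}))"
        by (intro span_add span_sum span_scale) (auto intro: span_base)
      then show "x \<in> span (Y \<union> (D - {b}))" by simp
    next
      fix x assume x: "x \<in> span (Y \<union> (D - {b}))"
      then show "x \<in> X" using D(2) span_mono[of "Y \<union> (D - {b})" "Y \<union> B"] by (auto simp: X_def)
      show "g b x = 0"
        by (rule linear_eq_0_on_span[OF g(1)[OF b] _ x]) (use g(2,3) b in auto)
    qed
    then show "closed {x\<in>X. g b x = 0}"
      using closed_span_Un_finite[of "D - {b}" Y] D Y by simp
  qed
  then obtain C where C: "\<And>b. b \<in> D \<Longrightarrow> C b \<ge> 0"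
    "\<And>b x. b \<in> D \<Longrightarrow> x \<in> X \<Longrightarrow> \<bar>g b x\<bar> \<le> C b * norm x" by metis
  have fx: "f x = (\<Sum>b\<in>D. g b x * f b)" if "x \<in> X" for x
    using f(2)[OF g(4)[OF that]] by (simp add: linear_diff[OF f(1)] linear_sum[OF f(1)] linear_cmul[OF f(1)])
  define U where "U = {x\<in>X. norm x \<le> 1}"
  have U0: "0 \<in> U" using X(1) by (simp add: U_def subspace_0)
  have gU: "\<bar>g b x\<bar> \<le> C b" if "b \<in> D" "x \<in> U" for b x
    using C(2)[OF that(1), of x] mult_left_mono[of "norm x" 1 "C b"] C(1)[OF that(1)] that(2)
    by (auto simp: U_def)
  have "f x \<le> (\<Sum>b\<in>D. C b * \<bar>f b\<bar>)" if "x \<in> U" for x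
  proof -
    have "f x \<le> \<bar>\<Sum>b\<in>D. g b x * f b\<bar>" using fx that by (auto simp: U_def)
    also have "\<dots> \<le> (\<Sum>b\<in>D. \<bar>g b x * f b\<bar>)" by (rule sum_abs)
    also have "\<dots> \<le> (\<Sum>b\<in>D. C b * \<bar>f b\<bar>)"
      using gU that by (intro sum_mono) (auto simp: abs_mult intro: mult_right_mono)
    finally show ?thesis .
  qed
  then have bddf: "bdd_above (f ` U)" by (auto simp: bdd_above_def)
  define s where "s = Sup (f ` U)"
  have le_s: "f z \<le> s" if "z \<in> U" for z using cSUP_upper[OF that bddf] by (simp add: s_def)
  have "\<exists>x\<in>U. s - 1 / Suc n < f x" for n
    using less_cSup_iff[OF _ bddf, of "s - 1 / Suc n"] U0 by (auto simp: s_def)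
  then obtain x where x: "\<And>n. x n \<in> U" "\<And>n. s - 1 / Suc n < f (x n)" by metis
  have "(\<lambda>n. f (x n)) \<longlonglongrightarrow> s"
  proof (rule tendsto_sandwich[OF _ _ _ tendsto_const])
    show "(\<lambda>n. s - 1 / Suc n) \<longlonglongrightarrow> s"
      using tendsto_diff[OF tendsto_const[of s] LIMSEQ_inverse_real_of_nat] by (simp add: inverse_eq_divide)
  qed (use x le_s in \<open>auto intro!: always_eventually less_imp_le\<close>)
  have "bounded (range (\<lambda>n. g b (x n)))" if "b \<in> D" for b
    using gU[OF that x(1)] by (intro boundedI[of _ "C b"]) auto
  from finite_convergent_subsequence[of D "\<lambda>n b. g b (x n)", OF D(1) this]
  obtain r c where r: "strict_mono r" "\<forall>b\<in>D. (\<lambda>n. g b (x (r n))) \<longlonglongrightarrow> c b" by blast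
  \<comment> \<open>A maximizing sequence in the ball need not converge, but its coordinates modulo
    \<open>Y\<close> do along \<open>r\<close>. The point \<open>p\<close> carries the limit
    coordinates; its norm may exceed 1, which a best approximation \<open>y\<close> from
    \<open>Y\<close> repairs without changing the value of \<open>f\<close>.\<close>
  define p where "p = (\<Sum>b\<in>D. c b *\<^sub>R b)"
  have pX: "p \<in> X" using D X unfolding p_def by (intro subspace_sum subspace_scale) auto
  have "(\<lambda>n. f (x (r n))) \<longlonglongrightarrow> s"
    using LIMSEQ_subseq_LIMSEQ[OF \<open>(\<lambda>n. f (x n)) \<longlonglongrightarrow> s\<close> r(1)] by (simp add: o_def)
  moreover have "(\<lambda>n. f (x (r n))) \<longlonglongrightarrow> f p"
  proof -
    have "(\<lambda>n. \<Sum>b\<in>D. g b (x (r n)) * f b) \<longlonglongrightarrow> (\<Sum>b\<in>D. c b * f b)"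
      using r by (intro tendsto_intros) auto
    moreover have "(\<Sum>b\<in>D. g b (x (r n)) * f b) = f (x (r n))" for n
      using fx[of "x (r n)"] x(1)[of "r n"] by (simp add: U_def)
    moreover have "(\<Sum>b\<in>D. c b * f b) = f p"
      by (simp add: p_def linear_sum[OF f(1)] linear_cmul[OF f(1)])
    ultimately show ?thesis by simp
  qed
  ultimately have fp: "f p = s" using LIMSEQ_unique by blast
  obtain y where y: "y \<in> Y" "norm (p - y) = (INF y'\<in>Y. norm (p - y'))"
    using prox pX unfolding proximinal_in_def X_def by blast
  have bb: "bdd_below ((\<lambda>y'. norm (p - y')) ` Y)" by (auto simp: bdd_below_def intro: exI[of _ 0])
  \<comment> \<open>Modulo \<open>Y\<close>, \<open>p\<close> differs from the unit ball element
    \<open>x (r n)\<close> only by the displayed sum, which tends to 0. So the distance from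
    \<open>p\<close> to \<open>Y\<close> is at most 1, and \<open>y\<close> attains it.\<close>
  have le: "norm (p - y) \<le> 1 + norm (\<Sum>b\<in>D. (c b - g b (x (r n))) *\<^sub>R b)" for n
  proof -
    let ?z = "x (r n)"
    have z: "?z \<in> X" "norm ?z \<le> 1" using x(1) by (auto simp: U_def)
    have "- (?z - (\<Sum>b\<in>D. g b ?z *\<^sub>R b)) \<in> Y" using g(4)[OF z(1)] Y(1) by (simp only: subspace_neg)
    then have "norm (p - y) \<le> norm (p - - (?z - (\<Sum>b\<in>D. g b ?z *\<^sub>R b)))"
      unfolding y(2) by (rule cINF_lower[OF bb])
    also have "p - - (?z - (\<Sum>b\<in>D. g b ?z *\<^sub>R b)) = ?z + (\<Sum>b\<in>D. (c b - g b ?z) *\<^sub>R b)"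
      by (simp add: p_def algebra_simps sum_subtractf)
    finally show ?thesis using norm_triangle_ineq[of ?z "\<Sum>b\<in>D. (c b - g b ?z) *\<^sub>R b"] z by linarith
  qed
  have "(\<lambda>n. 1 + norm (\<Sum>b\<in>D. (c b - g b (x (r n))) *\<^sub>R b)) \<longlonglongrightarrow> 1 + norm (\<Sum>b\<in>D. (c b - c b) *\<^sub>R b)"
    using r by (intro tendsto_intros) auto
  then have "norm (p - y) \<le> 1"
    using LIMSEQ_le_const[of _ _ "norm (p - y)"] le by auto
  moreover have "p - y \<in> X" using pX y X by (auto intro: subspace_diff)
  moreover have "f (p - y) = s" using fp f y by (simp add: linear_diff)
  ultimately show ?thesis using le_s unfolding U_def X_def by blast
qed

subsection \<open>Bounded sequences\<close>

lemma linfty_lift: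
  fixes f :: "nat \<Rightarrow> real"
  assumes "bounded (range f)"
  obtains x :: linfty where "\<And>k. apply_bcontfun x k = f k"
proof -
  have "f \<in> bcontfun" using assms by (simp add: bcontfun_def)
  then show ?thesis using that by (metis bcontfunE)
qed

lemma linfty_norm_le_iff: "norm (x::linfty) \<le> s \<longleftrightarrow> (\<forall>k. \<bar>apply_bcontfun x k\<bar> \<le> s)"
  using norm_bounded[of x] norm_bound[of x s] by (auto intro: order_trans)

lemma sum_apply_bcontfun:
  "apply_bcontfun (\<Sum>a\<in>A. g a) k = (\<Sum>a\<in>A. apply_bcontfun (g a :: linfty) k)"
  by (induction A rule: infinite_finite_induct) auto

definition unit_seq :: "nat \<Rightarrow> linfty" where
  "unit_seq k = Bcontfun (\<lambda>j. if j = k then 1 else 0)"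

lemma unit_seq_apply [simp]: "apply_bcontfun (unit_seq k) j = (if j = k then 1 else 0)"
  unfolding unit_seq_def
  by (subst Bcontfun_inverse) (auto simp: bcontfun_def intro!: boundedI[of _ 1])

text \<open>Written as a finite combination of unit vectors, so that membership in subspaces and
  norm limits follow from linearity.\<close>

definition trunc :: "nat \<Rightarrow> linfty \<Rightarrow> linfty" where
  "trunc N x = (\<Sum>k<N. apply_bcontfun x k *\<^sub>R unit_seq k)"

lemma trunc_apply [simp]: "apply_bcontfun (trunc N x) k = (if k < N then apply_bcontfun x k else 0)"
proof -
  have "apply_bcontfun (trunc N x) k = (\<Sum>j<N. if j = k then apply_bcontfun x k else 0)"
    unfolding trunc_def sum_apply_bcontfun by (intro sum.cong) auto
  then show ?thesis by simp
qed

lemma trunc_diff: "trunc N (x - y) = trunc N x - trunc N y"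
  by (rule bcontfun_eqI) auto

lemma norm_trunc_le: "norm (trunc N x) \<le> norm x"
  using linfty_norm_le_iff[of x "norm x"] by (auto simp: linfty_norm_le_iff)

lemma unit_seq_in_c0: "unit_seq k \<in> c0"
proof -
  have "eventually (\<lambda>j. apply_bcontfun (unit_seq k) j = 0) sequentially"
    using eventually_gt_at_top[of k] by eventually_elim auto
  then show ?thesis unfolding c0_def by (auto intro: tendsto_eventually)
qed

lemma subspace_c0: "subspace c0"
  unfolding subspace_def c0_def
  by (auto intro: tendsto_add_zero tendsto_mult_right_zero)

lemma trunc_tendsto:
  assumes "x \<in> c0"
  shows "(\<lambda>N. trunc N x) \<longlonglongrightarrow> x"
proof (rule LIMSEQ_I)
  fix e :: real assume e: "e > 0"
  have "apply_bcontfun x \<longlonglongrightarrow> 0" using assms by (simp add: c0_def)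
  from LIMSEQ_D[OF this, of "e/2"] obtain M where M: "\<forall>n\<ge>M. \<bar>apply_bcontfun x n\<bar> < e/2"
    using e by auto
  have "norm (trunc n x - x) \<le> e/2" if "n \<ge> M" for n
    unfolding linfty_norm_le_iff using M that e by (auto intro: less_imp_le)
  then show "\<exists>M. \<forall>n\<ge>M. norm (trunc n x - x) < e"
    using e by (intro exI[of _ M] allI impI) (smt (verit) field_sum_of_halves)
qed

section \<open>Norm-attaining functionals on \<open>c0\<close> and the tails contained in
  \<open>Y\<close>\<close>

text \<open>If \<open>f\<close> attains its maximum over the ball at \<open>x\<close> and \<open>\<bar>x\<^sub>k\<bar> < 1\<close>, then \<open>x\<close> can be perturbed
  in both directions along the \<open>k\<close>-th unit vector, which forces \<open>f\<close> to vanish there.\<close>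

lemma attaining_functional_finite_support:
  fixes f :: "linfty \<Rightarrow> real"
  assumes f: "linear f" and x: "x \<in> c0" "norm x \<le> 1"
    and max: "\<And>z. z \<in> c0 \<Longrightarrow> norm z \<le> 1 \<Longrightarrow> f z \<le> f x"
  shows "eventually (\<lambda>k. f (unit_seq k) = 0) sequentially"
proof -
  have "apply_bcontfun x \<longlonglongrightarrow> 0" using x by (simp add: c0_def)
  then have "eventually (\<lambda>k. \<bar>apply_bcontfun x k\<bar> < 1) sequentially"
    using tendstoD[of _ 0 sequentially 1] by fastforce
  then show ?thesis
  proof eventually_elim
    fix k assume k: "\<bar>apply_bcontfun x k\<bar> < 1"
    define t where "t = 1 - \<bar>apply_bcontfun x k\<bar>"
    have "f (x + u *\<^sub>R unit_seq k) \<le> f x" if "\<bar>u\<bar> = t" for u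
    proof (rule max)
      show "x + u *\<^sub>R unit_seq k \<in> c0"
        using x subspace_c0 unit_seq_in_c0 by (intro subspace_add subspace_scale)
      show "norm (x + u *\<^sub>R unit_seq k) \<le> 1"
        using x(2) that unfolding linfty_norm_le_iff t_def by auto
    qed
    from this[of t] this[of "- t"] have "t * f (unit_seq k) = 0"
      using k by (simp add: t_def linear_add[OF f] linear_diff[OF f] linear_cmul[OF f] del: mult_eq_0_iff)
        (simp add: algebra_simps)
    then show "f (unit_seq k) = 0" using k by (simp add: t_def)
  qed
qed

text \<open>Within \<open>c0\<close>, \<open>Y\<close> is the common kernel of the finitely many
  \<open>g b\<close>. Each attains its maximum on the unit ball and so kills all late unit vectors;
  these then lie in \<open>Y\<close>, and so do norm limits of their combinations.\<close>

lemma proximinal_contains_tails: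
  assumes Y: "subspace Y" "closed Y" and fc: "finite_codim_in Y c0" and prox: "proximinal_in Y c0"
  shows "\<exists>N. \<forall>x\<in>c0. (\<forall>k<N. apply_bcontfun x k = 0) \<longrightarrow> x \<in> Y"
proof -
  obtain B where B: "finite B" "c0 = span (Y \<union> B)"
    using fc unfolding finite_codim_in_def by blast
  obtain D g where "finite D \<and> D \<subseteq> B \<and>
    (\<forall>b\<in>D. linear (g b :: linfty \<Rightarrow> real) \<and> (\<forall>y\<in>Y. g b y = 0) \<and> (\<forall>d\<in>D. g b d = (if d = b then 1 else 0))) \<and>
    (\<forall>x\<in>c0. x - (\<Sum>b\<in>D. g b x *\<^sub>R b) \<in> Y)"
    using codim_coordinates[OF Y(1) B(1), folded B(2)] by (elim exE)
  then have D: "finite D" "D \<subseteq> B"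
    and g: "\<And>b. b \<in> D \<Longrightarrow> linear (g b)"
      "\<And>b y. b \<in> D \<Longrightarrow> y \<in> Y \<Longrightarrow> g b y = 0"
      "\<And>b d. b \<in> D \<Longrightarrow> d \<in> D \<Longrightarrow> g b d = (if d = b then 1 else 0)"
      "\<And>x. x \<in> c0 \<Longrightarrow> x - (\<Sum>b\<in>D. g b x *\<^sub>R b) \<in> Y"
    by blast+
  have "eventually (\<lambda>k. g b (unit_seq k) = 0) sequentially" if b: "b \<in> D" for b
  proof -
    obtain x where "x \<in> c0" "norm x \<le> 1" "\<And>z. z \<in> c0 \<Longrightarrow> norm z \<le> 1 \<Longrightarrow> g b z \<le> g b x"
      using proximinal_functional_attains[OF Y B(1) prox[unfolded B(2)] g(1)[OF b]] g(2)[OF b]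
      unfolding B(2) by blast
    then show ?thesis by (rule attaining_functional_finite_support[OF g(1)[OF b]])
  qed
  then have "eventually (\<lambda>k. \<forall>b\<in>D. g b (unit_seq k) = 0) sequentially"
    by (simp add: eventually_ball_finite D(1))
  then obtain N where N: "\<And>k b. k \<ge> N \<Longrightarrow> b \<in> D \<Longrightarrow> g b (unit_seq k) = 0"
    by (auto simp: eventually_sequentially)
  have unit: "unit_seq k \<in> Y" if "k \<ge> N" for k
    using g(4)[OF unit_seq_in_c0, of k] N[OF that] by simp
  have "x \<in> Y" if x: "x \<in> c0" "\<forall>k<N. apply_bcontfun x k = 0" for x
  proof (rule closed_sequentially[OF Y(2) _ trunc_tendsto[OF x(1)]])
    fix n
    show "trunc n x \<in> Y" unfolding trunc_def
    proof (rule subspace_sum[OF Y(1)])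
      fix k
      show "apply_bcontfun x k *\<^sub>R unit_seq k \<in> Y"
        using x(2) unit[of k] Y(1) by (cases "k < N") (auto simp: subspace_0 subspace_scale)
    qed
  qed
  then show ?thesis by blast
qed

text \<open>Such sequences are combinations of the first \<open>N\<close> unit vectors, so
  convergence of those \<open>N\<close> coordinates along a common subsequence is already norm
  convergence.\<close>

lemma compact_finitely_supported_ball:
  fixes Y :: "linfty set"
  assumes "closed Y"
  shows "compact {u\<in>Y. norm u \<le> 1 \<and> (\<forall>k\<ge>N. apply_bcontfun u k = 0)}" (is "compact ?K")
  unfolding compact_eq_seq_compact_metric seq_compact_def
proof (intro allI impI)
  fix u :: "nat \<Rightarrow> linfty" assume u: "\<forall>n. u n \<in> ?K"
  have "bounded (range (\<lambda>n. apply_bcontfun (u n) k))" for k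
    using u by (intro boundedI[of _ 1]) (auto simp: linfty_norm_le_iff)
  from finite_convergent_subsequence[of "{..<N}" "\<lambda>n. apply_bcontfun (u n)", OF finite_lessThan this]
  obtain r c where r: "strict_mono r" "\<forall>k\<in>{..<N}. (\<lambda>n. apply_bcontfun (u (r n)) k) \<longlonglongrightarrow> c k"
    by blast
  define l where "l = (\<Sum>k<N. c k *\<^sub>R unit_seq k)"
  have "(\<lambda>n. \<Sum>k<N. apply_bcontfun (u (r n)) k *\<^sub>R unit_seq k) \<longlonglongrightarrow> l"
    unfolding l_def using r by (intro tendsto_intros) auto
  moreover have "trunc N (u (r n)) = u (r n)" for n
    using u by (intro bcontfun_eqI) auto
  ultimately have lim: "(\<lambda>n. u (r n)) \<longlonglongrightarrow> l"
    by (simp add: trunc_def[symmetric])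
  have "l \<in> Y" using closed_sequentially[OF assms _ lim] u by auto
  moreover have "norm l \<le> 1"
    using LIMSEQ_le_const2[OF tendsto_norm[OF lim], of 1] u by auto
  moreover have "apply_bcontfun l k = 0" if "k \<ge> N" for k
    using that by (simp add: l_def sum_apply_bcontfun)
  ultimately show "\<exists>l\<in>?K. \<exists>r. strict_mono r \<and> (u \<circ> r) \<longlonglongrightarrow> l"
    using lim r(1) by (intro bexI[of _ l] exI[of _ r]) (auto simp: o_def)
qed

subsection \<open>Radii and near-centers\<close>

text \<open>The points of \<open>K\<close> far from the sublevel set form a compact set
  \<open>S\<close> on which \<open>g\<close> exceeds \<open>R\<close>, hence exceeds it by a fixed
  gap; \<open>d\<close> is half of that gap. An empty sublevel set is allowed: then
  \<open>S = K\<close> and no \<open>u\<close> satisfies the premise, so any \<open>u\<close> that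
  does satisfy it yields a point of the sublevel set.\<close>

lemma compact_near_sublevel:
  fixes g :: "'a::metric_space \<Rightarrow> real"
  assumes K: "compact K" and g: "continuous_on K g" and e: "e > 0"
  shows "\<exists>d>0. \<forall>u\<in>K. g u \<le> R + d \<longrightarrow> (\<exists>c\<in>K. g c \<le> R \<and> dist u c < e)"
proof -
  define S where "S = K - (\<Union>c\<in>{c\<in>K. g c \<le> R}. ball c e)"
  have S: "compact S" unfolding S_def by (intro compact_diff K open_UN) auto
  have SR: "g u > R" if "u \<in> S" for u
    using that e by (force simp: S_def)
  have near: "\<exists>c\<in>K. g c \<le> R \<and> dist u c < e" if "u \<in> K" "u \<notin> S" for u
    using that by (auto simp: S_def dist_commute)
  show ?thesis
  proof (cases "S = {}")
    case True
    then show ?thesis using near by (intro exI[of _ 1]) auto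
  next
    case False
    have "continuous_on S g" using g by (rule continuous_on_subset) (auto simp: S_def)
    from continuous_attains_inf[OF S False this]
    obtain m where m: "m \<in> S" "\<And>u. u \<in> S \<Longrightarrow> g m \<le> g u" by blast
    have "\<exists>c\<in>K. g c \<le> R \<and> dist u c < e" if "u \<in> K" "g u \<le> R + (g m - R) / 2" for u
      using near[OF that(1)] m(2)[of u] that(2) SR[OF m(1)] by argo
    then show ?thesis using SR[OF m(1)] by (intro exI[of _ "(g m - R) / 2"]) auto
  qed
qed

lemma remote_radius_le_iff:
  assumes F: "F \<noteq> {}" "bounded F"
  shows "remote_radius v F \<le> s \<longleftrightarrow> (\<forall>z\<in>F. norm (v - z) \<le> s)"
proof -
  obtain C where C: "\<forall>z\<in>F. norm z \<le> C" using F by (auto simp: bounded_iff)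
  have "norm (v - z) \<le> norm v + C" if "z \<in> F" for z
    using C that norm_triangle_ineq4[of v z] by fastforce
  then have "bdd_above ((\<lambda>z. norm (v - z)) ` F)" by (auto simp: bdd_above_def)
  then show ?thesis unfolding remote_radius_def using F by (simp add: cSUP_le_iff)
qed

lemma remote_radius_nonneg:
  assumes "F \<noteq> {}" "bounded F"
  shows "remote_radius v F \<ge> 0"
proof -
  have "\<forall>z\<in>F. norm (v - z) \<le> remote_radius v F"
    using remote_radius_le_iff[OF assms, of v "remote_radius v F"] by blast
  then show ?thesis using assms(1) norm_ge_zero order_trans by blast
qed

text \<open>By the triangle inequality the remote radius is 1-Lipschitz in the center.\<close>

lemma continuous_on_remote_radius:
  assumes F: "F \<noteq> {}" "bounded F"
  shows "continuous_on S (\<lambda>v. remote_radius v F)"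
proof -
  have le: "remote_radius v F \<le> remote_radius w F + dist v w" for v w
    unfolding remote_radius_le_iff[OF F]
  proof
    fix z assume "z \<in> F"
    then have "norm (w - z) \<le> remote_radius w F"
      using remote_radius_le_iff[OF F, of w "remote_radius w F"] by blast
    then show "norm (v - z) \<le> remote_radius w F + dist v w"
      using norm_triangle_ineq[of "v - w" "w - z"] by (simp add: dist_norm)
  qed
  have "dist (remote_radius v F) (remote_radius w F) \<le> dist v w" for v w
    using le[of v w] le[of w v] by (auto simp: dist_real_def dist_commute)
  then show ?thesis unfolding continuous_on_iff by (meson le_less_trans)
qed

lemma rad_le_remote_radius:
  assumes "F \<noteq> {}" "bounded F" "v \<in> V"
  shows "rad V F \<le> remote_radius v F"
  unfolding rad_def using remote_radius_nonneg[OF assms(1,2)]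
  by (intro cINF_lower assms(3)) (auto simp: bdd_below_def)

lemma near_rad_exists:
  assumes "F \<noteq> {}" "bounded F" "V \<noteq> {}" "d > 0"
  shows "\<exists>v\<in>V. remote_radius v F \<le> rad V F + d"
proof -
  have "bdd_below ((\<lambda>v. remote_radius v F) ` V)"
    using remote_radius_nonneg[OF assms(1,2)] by (auto simp: bdd_below_def)
  then have "\<exists>v\<in>V. remote_radius v F < rad V F + d"
    using cINF_less_iff[OF assms(3), of "\<lambda>v. remote_radius v F" "rad V F + d"] assms(4)
    by (simp add: rad_def)
  then show ?thesis by (auto intro: less_imp_le)
qed

text \<open>One approximation statement yields both halves of the property: applied with
  \<open>e = 1\<close> to a nearly optimal element it produces a center, and for general
  \<open>e\<close> it gives the inclusion of near-centers.\<close>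

lemma property_P1I:
  assumes V: "V \<noteq> {}"
    and approx: "\<And>F e. F \<in> \<F> \<Longrightarrow> e > 0 \<Longrightarrow> \<exists>d>0. \<forall>v\<in>V. remote_radius v F \<le> rad V F + d \<longrightarrow>
      (\<exists>w\<in>V. remote_radius w F \<le> rad V F \<and> norm (v - w) \<le> e)"
    and FCB: "\<F> \<subseteq> CB"
  shows "property_P1 V \<F>"
proof -
  have F: "F \<noteq> {}" "bounded F" if "F \<in> \<F>" for F using that FCB by (auto simp: CB_def)
  have cent: "w \<in> cent V F" if "F \<in> \<F>" "w \<in> V" "remote_radius w F \<le> rad V F" for w F
    using that rad_le_remote_radius[OF F[OF that(1)] that(2)] by (auto simp: cent_def)
  have "cent V F \<noteq> {}" if "F \<in> \<F>" for F
    using approx[OF that zero_less_one] near_rad_exists[OF F[OF that] V] cent[OF that] by blast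
  moreover have "\<exists>d>0. near_cent V F d \<subseteq> {c + e *\<^sub>R b | c b. c \<in> cent V F \<and> b \<in> cball 0 1}"
    if Fe: "F \<in> \<F>" "e > 0" for F e
  proof -
    obtain d where d: "d > 0" "\<forall>v\<in>V. remote_radius v F \<le> rad V F + d \<longrightarrow>
      (\<exists>w\<in>V. remote_radius w F \<le> rad V F \<and> norm (v - w) \<le> e)"
      using approx[OF Fe] by blast
    have "\<exists>c b. v = c + e *\<^sub>R b \<and> c \<in> cent V F \<and> b \<in> cball 0 1" if "v \<in> near_cent V F d" for v
    proof -
      obtain w where w: "w \<in> V" "remote_radius w F \<le> rad V F" "norm (v - w) \<le> e"
        using d \<open>v \<in> near_cent V F d\<close> by (auto simp: near_cent_def)
      have "v = w + e *\<^sub>R ((1/e) *\<^sub>R (v - w))" using Fe(2) by simp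
      moreover have "norm ((1/e) *\<^sub>R (v - w)) \<le> 1"
        unfolding norm_scaleR using w(3) Fe(2) by (simp add: field_simps)
      then have "(1/e) *\<^sub>R (v - w) \<in> cball 0 1" by (simp only: mem_cball_0)
      ultimately show ?thesis using cent[OF Fe(1) w(1,2)] by blast
    qed
    then show ?thesis using d(1) by blast
  qed
  ultimately show ?thesis unfolding property_P1_def rcp_def by blast
qed

text \<open>Coordinatewise clamping to the interval from \<open>sup z\<^sub>k - R\<close> to \<open>inf z\<^sub>k + R\<close>. The near-optimal
  elements of \<open>c\<^sub>0\<close> show that these intervals are non-empty, meet \<open>[-1, 1]\<close>, and come
  arbitrarily close to \<open>0\<close>; the last property keeps the clamped sequence in \<open>c\<^sub>0\<close>.\<close>

lemma clamp_in_c0: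
  fixes F :: "linfty set"
  assumes F: "F \<noteq> {}" "bounded F"
    and near: "\<And>\<eta>. \<eta> > 0 \<Longrightarrow> \<exists>u\<in>c0. norm u \<le> 1 \<and> remote_radius u F \<le> R + \<eta>"
    and v: "v \<in> c0" "norm v \<le> 1" "remote_radius v F \<le> R + d" and d: "d \<ge> 0"
  shows "\<exists>w\<in>c0. norm w \<le> 1 \<and> remote_radius w F \<le> R \<and> norm (v - w) \<le> d"
proof -
  obtain C where C: "\<forall>z\<in>F. norm z \<le> C" using F by (auto simp: bounded_iff)
  then have Ck: "\<bar>apply_bcontfun z k\<bar> \<le> C" if "z \<in> F" for z k
    using that by (auto simp: linfty_norm_le_iff)
  define a where "a k = (SUP z\<in>F. apply_bcontfun z k) - R" for k
  define b where "b k = (INF z\<in>F. apply_bcontfun z k) + R" for k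
  have bA: "bdd_above ((\<lambda>z. apply_bcontfun z k) ` F)" for k
    using Ck[of _ k] by (intro bdd_aboveI2[of _ _ C]) (auto simp: abs_le_iff)
  have bB: "bdd_below ((\<lambda>z. apply_bcontfun z k) ` F)" for k
    using Ck[of _ k] by (intro bdd_belowI2[of _ "- C"]) (force simp: abs_le_iff)
  \<comment> \<open>The radius condition decouples: each coordinate of \<open>u\<close> is confined
    to its own interval, enlarged by \<open>t\<close> at both ends.\<close>
  have rr: "remote_radius u F \<le> R + t \<longleftrightarrow> (\<forall>k. a k - t \<le> apply_bcontfun u k \<and> apply_bcontfun u k \<le> b k + t)"
    for u t
  proof -
    have 1: "a k - t \<le> apply_bcontfun u k \<longleftrightarrow> (\<forall>z\<in>F. apply_bcontfun z k \<le> apply_bcontfun u k + R + t)" for k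
      using cSUP_le_iff[OF F(1) bA, of k "apply_bcontfun u k + R + t"] by (simp add: a_def algebra_simps)
    have 2: "apply_bcontfun u k \<le> b k + t \<longleftrightarrow> (\<forall>z\<in>F. apply_bcontfun u k - R - t \<le> apply_bcontfun z k)" for k
      using le_cINF_iff[OF F(1) bB, of "apply_bcontfun u k - R - t" k] by (simp add: b_def algebra_simps)
    show ?thesis
      unfolding remote_radius_le_iff[OF F] linfty_norm_le_iff minus_bcontfun.rep_eq 1 2
      by (auto simp: abs_le_iff algebra_simps)
  qed
  have gap: "a k \<le> b k + \<eta> \<and> a k \<le> 1 + \<eta> \<and> -1 \<le> b k + \<eta>" if "\<eta> > 0" for k \<eta>
  proof -
    obtain u where u: "norm u \<le> 1" "remote_radius u F \<le> R + \<eta> / 2"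
      using near[of "\<eta> / 2"] \<open>\<eta> > 0\<close> by auto
    have "\<bar>apply_bcontfun u k\<bar> \<le> 1" "a k - \<eta>/2 \<le> apply_bcontfun u k" "apply_bcontfun u k \<le> b k + \<eta>/2"
      using u by (auto simp: linfty_norm_le_iff rr)
    then show ?thesis using \<open>\<eta> > 0\<close> by argo
  qed
  \<comment> \<open>Letting the error in \<open>gap\<close> tend to 0 gives the exact
    inequalities.\<close>
  then have ab: "a k \<le> b k" "a k \<le> 1" "-1 \<le> b k" for k
    by (rule_tac field_le_epsilon, simp)+
  have v1: "\<bar>apply_bcontfun v k\<bar> \<le> 1" "a k - d \<le> apply_bcontfun v k" "apply_bcontfun v k \<le> b k + d" for k
    using v by (auto simp: linfty_norm_le_iff rr)
  \<comment> \<open>Since \<open>v\<close> violates the bounds by at most \<open>d\<close>, clamping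
    moves it by at most \<open>d\<close>. The values stay in [-1, 1] because each interval meets
    [-1, 1].\<close>
  define cl where "cl k = max (a k) (min (b k) (apply_bcontfun v k))" for k
  have cl: "\<bar>cl k\<bar> \<le> 1" "a k \<le> cl k" "cl k \<le> b k" "\<bar>apply_bcontfun v k - cl k\<bar> \<le> d" for k
    using ab[of k] v1[of k] d by (auto simp: cl_def max_def min_def)
  have "bounded (range cl)" using cl(1) by (intro boundedI[of _ 1]) auto
  then obtain w :: linfty where w: "\<And>k. apply_bcontfun w k = cl k" using linfty_lift by blast
  have "cl \<longlonglongrightarrow> 0"
  proof (rule LIMSEQ_I)
    fix e :: real assume e: "e > 0"
    obtain u where u: "u \<in> c0" "remote_radius u F \<le> R + e / 4"
      using near[of "e / 4"] e by auto
    obtain M where M: "\<And>n. n \<ge> M \<Longrightarrow> \<bar>apply_bcontfun u n\<bar> < e / 4"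
      using LIMSEQ_D[of "apply_bcontfun u" 0 "e/4"] u(1) e by (auto simp: c0_def)
    obtain M' where M': "\<And>n. n \<ge> M' \<Longrightarrow> \<bar>apply_bcontfun v n\<bar> < e / 4"
      using LIMSEQ_D[of "apply_bcontfun v" 0 "e/4"] v(1) e by (auto simp: c0_def)
    \<comment> \<open>Here \<open>a n < e/2\<close> and \<open>b n > -e/2\<close> by means of
      \<open>u\<close>, and \<open>v n\<close> is within \<open>e/4\<close> of 0, so the clamped
      value is within \<open>e/2\<close> of 0.\<close>
    have "norm (cl n - 0) < e" if "n \<ge> max M M'" for n
    proof -
      have "a n - e/4 \<le> apply_bcontfun u n" "apply_bcontfun u n \<le> b n + e/4"
        using u(2) by (auto simp: rr)
      moreover have "\<bar>apply_bcontfun u n\<bar> < e / 4" "\<bar>apply_bcontfun v n\<bar> < e / 4"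
        using M M' that by auto
      ultimately show ?thesis using e ab(1)[of n] by (auto simp: cl_def max_def min_def)
    qed
    then show "\<exists>M. \<forall>n\<ge>M. norm (cl n - 0) < e" by blast
  qed
  moreover have "apply_bcontfun w = cl" using w by (rule ext)
  ultimately have "w \<in> c0" by (simp add: c0_def)
  moreover have "norm w \<le> 1" "norm (v - w) \<le> d" using cl w by (auto simp: linfty_norm_le_iff)
  moreover have "remote_radius w F \<le> R" using rr[of w 0] cl w by auto
  ultimately show ?thesis by blast
qed

section \<open>Correcting near-centers in the unit ball of \<open>Y\<close>\<close>

theorem proposition3p7:
  fixes Y :: "linfty set"
  assumes "subspace Y" and "closed Y" and "Y \<subseteq> c0"
    and "finite_codim_in Y c0"
    and "proximinal_in Y c0"
  shows "property_P1 (Y \<inter> cball 0 1) (CB :: linfty set set)"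
proof (rule property_P1I)
  show V0: "Y \<inter> cball 0 1 \<noteq> {}" using subspace_0[OF assms(1)] by auto
  obtain N where N: "\<And>x. x \<in> c0 \<Longrightarrow> \<forall>k<N. apply_bcontfun x k = 0 \<Longrightarrow> x \<in> Y"
    using proximinal_contains_tails[OF assms(1,2,4,5)] by blast
  \<comment> \<open>For null sequences, membership in \<open>Y\<close> is decided by the first
    \<open>N\<close> coordinates.\<close>
  have glue: "x \<in> Y" if "x \<in> c0" "y \<in> Y" "\<forall>k<N. apply_bcontfun x k = apply_bcontfun y k" for x y
  proof -
    have "x - y \<in> Y" by (rule N) (use that assms(3) subspace_c0 in \<open>auto intro: subspace_diff\<close>)
    then have "(x - y) + y \<in> Y" using assms(1) that(2) by (intro subspace_add)
    then show ?thesis by simp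
  qed
  have trunc_c0: "trunc N x \<in> c0" for x
    unfolding trunc_def by (intro subspace_sum subspace_scale subspace_c0 unit_seq_in_c0)
  fix F :: "linfty set" and e :: real assume "F \<in> CB" and e: "e > 0"
  then have F: "F \<noteq> {}" "bounded F" by (auto simp: CB_def)
  define V where "V = Y \<inter> cball 0 1"
  define R where "R = rad V F"
  \<comment> \<open>The head of the problem: \<open>FN\<close> is \<open>F\<close> cut to the first
    \<open>N\<close> coordinates and \<open>K\<close> is the compact set of candidate heads. They
    are tested against the radius \<open>R\<close> of the full problem.\<close>
  define FN where "FN = trunc N ` F"
  define K where "K = {u\<in>Y. norm u \<le> 1 \<and> (\<forall>k\<ge>N. apply_bcontfun u k = 0)}"
  obtain C where C: "\<forall>z\<in>F. norm z \<le> C" using F by (auto simp: bounded_iff)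
  have FN: "FN \<noteq> {}" "bounded FN"
    using F C norm_trunc_le order_trans unfolding FN_def bounded_iff by blast+
  have "compact K" unfolding K_def by (rule compact_finitely_supported_ball[OF assms(2)])
  from compact_near_sublevel[OF this continuous_on_remote_radius[OF FN] e]
  obtain d where d: "d > 0" "\<And>u. u \<in> K \<Longrightarrow> remote_radius u FN \<le> R + d \<Longrightarrow>
      \<exists>c\<in>K. remote_radius c FN \<le> R \<and> dist u c < e" by blast
  have near: "\<exists>u\<in>c0. norm u \<le> 1 \<and> remote_radius u F \<le> R + \<eta>" if "\<eta> > 0" for \<eta>
    using near_rad_exists[OF F V0 that] assms(3) by (auto simp: R_def V_def)
  show "\<exists>d>0. \<forall>v\<in>Y \<inter> cball 0 1. remote_radius v F \<le> rad (Y \<inter> cball 0 1) F + d \<longrightarrow>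
      (\<exists>w\<in>Y \<inter> cball 0 1. remote_radius w F \<le> rad (Y \<inter> cball 0 1) F \<and> norm (v - w) \<le> e)"
    unfolding V_def[symmetric] R_def[symmetric]
  \<comment> \<open>The bound \<open>d\<close> serves the compact head; \<open>e\<close> serves the
    tail, which clamping moves by no more than the excess of the radius over
    \<open>R\<close>.\<close>
  proof (intro exI[of _ "min d e"] conjI ballI impI)
    show "0 < min d e" using d(1) e by simp
    fix v assume "v \<in> V" and vr: "remote_radius v F \<le> R + min d e"
    then have v: "v \<in> Y" "v \<in> c0" "norm v \<le> 1" using assms(3) by (auto simp: V_def)
    have "remote_radius (trunc N v) FN \<le> R + d"
      unfolding remote_radius_le_iff[OF FN]
    proof
      fix z assume "z \<in> FN"
      then obtain y where y: "y \<in> F" "z = trunc N y" by (auto simp: FN_def)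
      have "norm (trunc N v - z) \<le> norm (v - y)"
        using norm_trunc_le[of N "v - y"] by (simp add: y trunc_diff)
      also have "\<dots> \<le> R + min d e" using vr y(1) by (auto simp: remote_radius_le_iff[OF F])
      finally show "norm (trunc N v - z) \<le> R + d" by simp
    qed
    moreover have "trunc N v \<in> K"
      using glue[OF trunc_c0 v(1)] norm_trunc_le[of N v] v(3) by (auto simp: K_def)
    ultimately obtain c where c: "c \<in> K" "remote_radius c FN \<le> R" "dist (trunc N v) c < e"
      using d(2) by blast
    obtain t where t: "t \<in> c0" "norm t \<le> 1" "remote_radius t F \<le> R" "norm (v - t) \<le> min d e"
      using clamp_in_c0[OF F near v(2,3) vr] d(1) e by auto
    \<comment> \<open>The clamped \<open>t\<close> lies in \<open>c0\<close> but perhaps not in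
      \<open>Y\<close>. Only its tail is kept; the head comes from \<open>c\<close>, which lies in
      \<open>Y\<close>, so \<open>glue\<close> puts \<open>w\<close> into \<open>Y\<close>.\<close>
    define w where "w = c + (t - trunc N t)"
    have wk: "apply_bcontfun w k = (if k < N then apply_bcontfun c k else apply_bcontfun t k)" for k
      using c(1) by (auto simp: w_def K_def)
    have "w \<in> c0" unfolding w_def
      using c(1) t(1) assms(3) trunc_c0 by (auto simp: K_def intro!: subspace_add subspace_diff subspace_c0)
    then have "w \<in> Y" using glue[of w c] wk c(1) by (auto simp: K_def)
    moreover have "norm w \<le> 1"
      using c(1) t(2) by (auto simp: linfty_norm_le_iff wk K_def)
    moreover have "remote_radius w F \<le> R"
      unfolding remote_radius_le_iff[OF F] linfty_norm_le_iff
    proof (intro ballI allI)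
      fix z k assume z: "z \<in> F"
      \<comment> \<open>The first bound controls the coordinates below \<open>N\<close>, the second
        all others.\<close>
      have "norm (c - trunc N z) \<le> R" "norm (t - z) \<le> R"
        using c(2) t(3) z unfolding remote_radius_le_iff[OF F] remote_radius_le_iff[OF FN]
        by (auto simp: FN_def)
      then have "\<bar>apply_bcontfun (c - trunc N z) k\<bar> \<le> R" "\<bar>apply_bcontfun (t - z) k\<bar> \<le> R"
        by (simp_all only: linfty_norm_le_iff)
      then show "\<bar>apply_bcontfun (w - z) k\<bar> \<le> R" by (auto simp: wk split: if_splits)
    qed
    moreover have "norm (v - w) \<le> e"
      unfolding linfty_norm_le_iff
    proof
      fix k
      have "norm (trunc N v - c) \<le> e" "norm (v - t) \<le> e" using c(3) t(4) by (auto simp: dist_norm)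
      then have "\<bar>apply_bcontfun (trunc N v - c) k\<bar> \<le> e" "\<bar>apply_bcontfun (v - t) k\<bar> \<le> e"
        by (simp_all only: linfty_norm_le_iff)
      then show "\<bar>apply_bcontfun (v - w) k\<bar> \<le> e" by (auto simp: wk split: if_splits)
    qed
    ultimately show "\<exists>w\<in>V. remote_radius w F \<le> R \<and> norm (v - w) \<le> e" by (auto simp: V_def)
  qed
qed simp

end
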